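(* There exists an undirected triangle-free simple graph $G$ on $100$ vertices with $\operatorname{gn}(G) \geq 77$, where $\operatorname{gn}(G)$ is the asymptotic guessing number of $G$.
   Context: All graphs are finite, undirected and simple (no loops, no multiple edges). For a graph $G$ and a vertex $v \in V(G)$, $\Gamma(v) = \{u : uv \in E(G)\}$ is the neighbourhood of $v$. A graph is triangle-free if it contains no three pairwise adjacent vertices. Guessing game. Let $s \geq 2$ be an integer and $A_s = \{0,1,\dots,s-1\}$. In the game $(G,s)$ each vertex $v \in V(G)$ (a player) is assigned a value $a_v \in A_s$, uniformly and independently at random. Player $v$ sees exactly the values $(a_u)_{u \in \Gamma(v)}$ (knowing which value belongs to which neighbour) and guesses its own value. A strategy $\mathcal{F} = (f_v)_{v \in V(G)}$ is a tuple of deterministic functions $f_v : A_s^{\Gamma(v)} \to A_s$, where $f_v$ gives the guess of player $v$. The event $\mathrm{Win}(G,s,\mathcal{F})$ is that every player guesses correctly, i.e. $f_v((a_u)_{u\in\Gamma(v)}) = a_v$ for all $v \in V(G)$. Define $$\operatorname{gn}(G,s) = |V(G)| + \log_s\Big(\max_{\mathcal{F}} \mathbf{P}[\mathrm{Win}(G,s,\mathcal{F})]\Big),$$ and the asymptotic guessing number $$\operatorname{gn}(G) = \lim_{s \to \infty} \operatorname{gn}(G,s).$$ This limit is known to exist for every graph $G$. *)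

theory Defs
  imports "HOL-Probability.Probability" "Graph_Theory.Graph_Theory"
begin

text \<open>
  A finite undirected simple graph is a \<^locale>\<open>pair_graph\<close>: a finite vertex set with a
  symmetric irreflexive adjacency relation, so that every edge \<open>uv\<close> is represented by the two
  arcs \<open>(u, v)\<close> and \<open>(v, u)\<close>.
\<close>

definition neighbourhood :: "'a pair_pre_digraph \<Rightarrow> 'a \<Rightarrow> 'a set" where
  "neighbourhood G v = {u. (v, u) \<in> parcs G}"

definition triangle_free :: "'a pair_pre_digraph \<Rightarrow> bool" where
  "triangle_free G \<longleftrightarrow>
     \<not> (\<exists>x y z. (x, y) \<in> parcs G \<and> (y, z) \<in> parcs G \<and> (x, z) \<in> parcs G)"

text \<open>
  Functions with a restricted domain, here the assignments and the guesses of the players, are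
  extensional (\<open>undefined\<close> outside their domain), so there are only finitely many strategies.
\<close>

definition strategies :: "'a pair_pre_digraph \<Rightarrow> nat \<Rightarrow> ('a \<Rightarrow> ('a \<Rightarrow> nat) \<Rightarrow> nat) set" where
  "strategies G s =
     (\<Pi>\<^sub>E v\<in>pverts G. (neighbourhood G v \<rightarrow>\<^sub>E {..<s}) \<rightarrow>\<^sub>E {..<s})"

text \<open>The values of the players are independent and uniform on \<open>{0, \<dots>, s - 1}\<close>.\<close>

definition assignment_pmf :: "'a pair_pre_digraph \<Rightarrow> nat \<Rightarrow> ('a \<Rightarrow> nat) pmf" where
  "assignment_pmf G s = Pi_pmf (pverts G) undefined (\<lambda>_. pmf_of_set {..<s})"

definition Win :: "'a pair_pre_digraph \<Rightarrow> ('a \<Rightarrow> ('a \<Rightarrow> nat) \<Rightarrow> nat) \<Rightarrow> ('a \<Rightarrow> nat) set" where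
  "Win G F = {a. \<forall>v\<in>pverts G. F v (restrict a (neighbourhood G v)) = a v}"

text \<open>Meaningful for \<open>s \<ge> 2\<close> only; the smaller values do not affect the limit below.\<close>

definition guessing_number_at :: "'a pair_pre_digraph \<Rightarrow> nat \<Rightarrow> real" where
  "guessing_number_at G s =
     real (card (pverts G)) +
     log (real s) (Max ((\<lambda>F. measure_pmf.prob (assignment_pmf G s) (Win G F)) ` strategies G s))"

text \<open>
  The sequence converges for every finite graph, so that \<^const>\<open>lim\<close> is its limit rather than an
  unspecified value.
\<close>

definition guessing_number :: "'a pair_pre_digraph \<Rightarrow> real" where
  "guessing_number G = lim (\<lambda>s. guessing_number_at G s)"

end

theory Submission
  imports Defs "HOL-Real_Asymp.Real_Asymp"
begin

text \<open>
  The graph is the Higman-Sims graph, which is triangle-free on 100 vertices and whose adjacency matrix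
  \<open>A\<close> has the eigenvalue \<open>2\<close> with multiplicity \<open>77\<close>. Thus \<open>A - 2 I\<close> has rank \<open>23\<close> over the rationals, and
  its reduction \<open>A + I\<close> modulo 3 has rank at most \<open>23\<close>. With alphabet size 3, let the players guess minus
  the sum of the values they see, modulo 3: they all win exactly on the kernel of \<open>A + I\<close>, which contains at
  least $3^{77}$ of the $3^{100}$ assignments.

  Two points turn this into a short elementary proof. First, one alphabet is enough. The maximal
  number \<open>M s\<close> of assignments on which one strategy wins is monotone and supermultiplicative in \<open>s\<close>
  (\<open>mono_max_winnable\<close>, \<open>max_winnable_supermultiplicative\<close>), so \<open>log s (M s)\<close> converges to its supremum
  and the guessing number is at least the value at \<open>s = 3\<close>
  (\<open>guessing_number_at_le_guessing_number\<close>).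

  Second, the rank bound has an explicit witness. The graph is built from the Steiner system \<open>S(3, 6, 22)\<close>,
  and the rows of \<open>A + I\<close> modulo 3 are combinations of 23 explicit checks, one for each of the 22 points
  and one for the hexads together (\<open>higman_sims_checks_determine_vertex\<close>). Two assignments with the same
  checks that agree on the neighbourhood of a vertex therefore agree at the vertex, so each fibre of the
  checks can be won by one strategy. As there are at most $3^{23}$ fibres, one of them has
  at least $3^{77}$ elements (\<open>guessing_number_at_ge_of_checks\<close>).

  For triangles, note that the vertex joined to all points has no other neighbours, that points are not
  adjacent to each other, and that hexads are adjacent only if they are disjoint. So a triangle
  would consist of three pairwise disjoint hexads, and there are none by a count of incidences in the
  design (\<open>no_three_disjoint_hexads\<close>).
\<close>

section \<open>Growth of monotone supermultiplicative sequences\<close>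

text \<open>
  A Fekete-type argument. If $r^k \le t < r^{k+1}$, then \<open>M t \<ge> M (r ^ k) \<ge> M r ^ k\<close>, and
  \<open>k > log r t - 1\<close>, so \<open>log t (M t)\<close> is at least \<open>log r (M r)\<close> up to an error of order
  \<open>1 / ln t\<close>. Hence every single value \<open>log r (M r)\<close> is asymptotically a lower bound.
\<close>

lemma supermultiplicative_log_tendsto_SUP:
  fixes M :: "nat \<Rightarrow> nat"
  assumes mono: "mono M"
    and pos: "\<And>s. s \<ge> 1 \<Longrightarrow> M s \<ge> 1"
    and supermult: "\<And>s t. M s * M t \<le> M (s * t)"
    and bdd: "bdd_above ((\<lambda>s. log (real s) (real (M s))) ` {2..})"
  shows "(\<lambda>s. log (real s) (real (M s))) \<longlonglongrightarrow> (SUP s\<in>{2..}. log (real s) (real (M s)))"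
    (is "?f \<longlonglongrightarrow> ?L")
proof (rule order_tendstoI)
  fix y assume "?L < y"
  have "?f s < y" if "s \<ge> 2" for s
    using cSUP_upper[OF _ bdd, of s] that \<open>?L < y\<close> by auto
  then show "\<forall>\<^sub>F s in sequentially. ?f s < y"
    by (intro eventually_sequentiallyI[of 2])
next
  fix y assume "y < ?L"
  then obtain r where r: "r \<ge> 2" "y < ?f r"
    using less_cSUP_iff[OF _ bdd] by auto
  have power_le: "M r ^ k \<le> M (r ^ k)" for k
  proof (induction k)
    case 0
    show ?case using pos[of 1] by simp
  next
    case (Suc k)
    have "M r ^ Suc k \<le> M r * M (r ^ k)" using Suc by simp
    also have "\<dots> \<le> M (r ^ Suc k)" using supermult[of r "r ^ k"] by simp
    finally show ?case .
  qed
  have lower: "?f r - ?f r * (ln r / ln t) \<le> ?f t" if t: "t \<ge> r" for t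
  proof -
    define k where "k = nat \<lfloor>log r t\<rfloor>"
    have t2: "t \<ge> 2" using r t by linarith
    have log_t: "log r t \<ge> 1" using r t by simp
    have k: "real k \<le> log r t" "log r t \<le> real k + 1"
      unfolding k_def using log_t by linarith+
    have "real (r ^ k) = r powr real k"
      using r by (simp add: powr_realpow)
    also have "\<dots> \<le> r powr (log r t)"
      using r k by (intro powr_mono) auto
    also have "\<dots> = real t" using r t2 by simp
    finally have "r ^ k \<le> t" by linarith
    then have "M r ^ k \<le> M t"
      using power_le[of k] monoD[OF mono, of "r ^ k" t] by linarith
    then have "real (M r) ^ k \<le> real (M t)"
      by (metis of_nat_le_iff of_nat_power)
    moreover have "M r \<ge> 1" "M t \<ge> 1" using pos[of r] pos[of t] r t2 by auto
    ultimately have "ln (real (M r) ^ k) \<le> ln (real (M t))"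
      by (subst ln_le_cancel_iff) auto
    then have Mt: "real k * ln (M r) \<le> ln (M t)"
      using \<open>M r \<ge> 1\<close> by (simp add: ln_realpow)
    have "(log r t - 1) * ln (M r) \<le> real k * ln (M r)"
      using k \<open>M r \<ge> 1\<close> by (intro mult_right_mono) auto
    with Mt have "(log r t - 1) * ln (M r) \<le> ln (M t)" by linarith
    then have "(log r t - 1) * ln (M r) / ln t \<le> ln (M t) / ln t"
      using t2 by (intro divide_right_mono) auto
    moreover have "(log r t - 1) * ln (M r) / ln t = ?f r - ?f r * (ln r / ln t)"
    proof -
      have f: "?f r = ln (M r) / ln r" and rt: "log r t = ln t / ln r"
        by (rule log_def)+
      have "ln r > 0" "ln t > 0" using r(1) t2 by simp_all
      then show ?thesis unfolding f rt by (simp add: field_simps)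
    qed
    moreover have "?f t = ln (M t) / ln t" by (rule log_def)
    ultimately show ?thesis by linarith
  qed
  have "(\<lambda>t. c - c * (ln r / ln (real t))) \<longlonglongrightarrow> c" for c :: real
    by real_asymp
  then have "\<forall>\<^sub>F t in sequentially. y < ?f r - ?f r * (ln r / ln (real t))"
    using r by (intro order_tendstoD)
  then show "\<forall>\<^sub>F t in sequentially. y < ?f t"
    using eventually_ge_at_top[of r]
    by eventually_elim (use lower in force)
qed

section \<open>Winnable sets of assignments and the limit\<close>

definition assignments :: "'a pair_pre_digraph \<Rightarrow> nat \<Rightarrow> ('a \<Rightarrow> nat) set" where
  "assignments G s = pverts G \<rightarrow>\<^sub>E {..<s}"

text \<open>
  A set of assignments can be won by one common strategy iff, on that set, the value of every player
  is a function of the values that the player sees. This reformulation no longer mentions strategies,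
  which is what makes the dependence on \<open>s\<close> tractable.
\<close>

definition winnable :: "'a pair_pre_digraph \<Rightarrow> nat \<Rightarrow> ('a \<Rightarrow> nat) set \<Rightarrow> bool" where
  "winnable G s S \<longleftrightarrow> S \<subseteq> assignments G s \<and>
     (\<forall>a\<in>S. \<forall>b\<in>S. \<forall>v\<in>pverts G. (\<forall>u\<in>neighbourhood G v. a u = b u) \<longrightarrow> a v = b v)"

lemma winnable_less: "\<lbrakk>winnable G s S; a \<in> S; v \<in> pverts G\<rbrakk> \<Longrightarrow> a v < s"
  unfolding winnable_def assignments_def by blast

lemma winnable_extensional: "\<lbrakk>winnable G s S; a \<in> S\<rbrakk> \<Longrightarrow> a \<in> extensional (pverts G)"
  unfolding winnable_def assignments_def PiE_def by blast

lemma winnable_eq: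
  assumes "winnable G s S" "a \<in> S" "b \<in> S" "v \<in> pverts G"
    and "\<And>u. u \<in> neighbourhood G v \<Longrightarrow> a u = b u"
  shows "a v = b v"
  using assms unfolding winnable_def by blast

definition max_winnable :: "'a pair_pre_digraph \<Rightarrow> nat \<Rightarrow> nat" where
  "max_winnable G s = Max (card ` {S. winnable G s S})"

lemma winnable_Win: "winnable G s (Win G F \<inter> assignments G s)"
  unfolding winnable_def
proof (intro conjI ballI impI)
  fix a b v
  assume "a \<in> Win G F \<inter> assignments G s" "b \<in> Win G F \<inter> assignments G s" "v \<in> pverts G"
    and eq: "\<forall>u\<in>neighbourhood G v. a u = b u"
  then have "a v = F v (restrict a (neighbourhood G v))" "b v = F v (restrict b (neighbourhood G v))"
    by (auto simp: Win_def)
  moreover have "restrict a (neighbourhood G v) = restrict b (neighbourhood G v)"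
    using eq by (auto simp: restrict_def)
  ultimately show "a v = b v" by simp
qed auto

context pair_fin_digraph
begin

lemma neighbourhood_subset: "neighbourhood G v \<subseteq> pverts G"
  by (auto simp: neighbourhood_def dest: in_arcsD2)

lemma finite_assignments [simp]: "finite (assignments G s)"
  unfolding assignments_def using pair_finite_verts by (intro finite_PiE) auto

lemma card_assignments: "card (assignments G s) = s ^ card (pverts G)"
  unfolding assignments_def using pair_finite_verts by (simp add: card_funcsetE)

lemma finite_strategies: "finite (strategies G s)"
  unfolding strategies_def
  using pair_finite_verts finite_subset[OF neighbourhood_subset pair_finite_verts]
  by (intro finite_PiE) auto

text \<open>
  Each player looks for some member of \<open>S\<close> that is consistent with what it sees and guesses its own
  value there; winnability makes the choice of that member irrelevant.
\<close>

lemma winnable_strategy: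
  assumes S: "winnable G s S" and s: "s \<ge> 1"
  obtains F where "F \<in> strategies G s" "S \<subseteq> Win G F"
proof
  define view where "view a v = restrict a (neighbourhood G v)" for a :: "'a \<Rightarrow> nat" and v
  define witness where "witness v h = (SOME a. a \<in> S \<and> view a v = h)" for v h
  have witness: "witness v (view a v) \<in> S" "view (witness v (view a v)) v = view a v"
    if "a \<in> S" for a v
    using someI[of "\<lambda>b. b \<in> S \<and> view b v = view a v" a] that unfolding witness_def by blast+
  \<comment> \<open>The guess 0 on the remaining views is arbitrary: they do not occur for assignments in \<open>S\<close>.\<close>
  define guess where "guess v h = (if h \<in> (\<lambda>a. view a v) ` S then witness v h v else 0)" for v h
  define F where "F = (\<lambda>v\<in>pverts G. \<lambda>h\<in>neighbourhood G v \<rightarrow>\<^sub>E {..<s}. guess v h)"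
  have "guess v h < s" if "v \<in> pverts G" for v h
    using winnable_less[OF S witness(1) that] s unfolding guess_def by auto
  then show "F \<in> strategies G s"
    unfolding strategies_def F_def by (intro restrict_PiE_iff[THEN iffD2] ballI) simp
  show "S \<subseteq> Win G F"
  proof
    fix a assume a: "a \<in> S"
    have "F v (view a v) = a v" if v: "v \<in> pverts G" for v
    proof -
      have "witness v (view a v) u = a u" if "u \<in> neighbourhood G v" for u
        using fun_cong[OF witness(2)[OF a, of v], of u] that by (simp add: view_def)
      then have "witness v (view a v) v = a v"
        by (rule winnable_eq[OF S witness(1)[OF a] a v])
      moreover have "view a v \<in> neighbourhood G v \<rightarrow>\<^sub>E {..<s}"
        using winnable_less[OF S a] neighbourhood_subset[of v] unfolding view_def by auto
      ultimately show ?thesis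
        using a v by (simp add: F_def guess_def)
    qed
    then show "a \<in> Win G F" by (simp add: Win_def view_def)
  qed
qed

lemma finite_winnable: "finite {S. winnable G s S}"
  by (rule finite_subset[of _ "Pow (assignments G s)"]) (auto simp: winnable_def)

lemma card_le_max_winnable: "winnable G s S \<Longrightarrow> card S \<le> max_winnable G s"
  unfolding max_winnable_def using finite_winnable by (intro Max_ge) auto

lemma max_winnable_attained:
  obtains S where "winnable G s S" "card S = max_winnable G s"
proof -
  have "winnable G s {}" by (simp add: winnable_def)
  then have "max_winnable G s \<in> card ` {S. winnable G s S}"
    unfolding max_winnable_def using finite_winnable by (intro Max_in) auto
  then show ?thesis using that by auto
qed

lemma max_winnable_pos:
  assumes "s \<ge> 1"
  shows "max_winnable G s \<ge> 1"
proof -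
  have "winnable G s {\<lambda>v\<in>pverts G. 0}"
    using assms by (auto simp: winnable_def assignments_def)
  from card_le_max_winnable[OF this] show ?thesis by simp
qed

lemma max_winnable_le: "max_winnable G s \<le> s ^ card (pverts G)"
proof -
  obtain S where S: "winnable G s S" "card S = max_winnable G s"
    by (rule max_winnable_attained)
  then have "card S \<le> card (assignments G s)"
    by (intro card_mono) (auto simp: winnable_def)
  with S show ?thesis by (simp add: card_assignments)
qed

text \<open>
  Winnability refers to the alphabet only through the range of the values, so a winnable set stays
  winnable over a larger alphabet.
\<close>

lemma mono_max_winnable: "mono (max_winnable G)"
proof
  fix s t :: nat assume "s \<le> t"
  obtain S where S: "winnable G s S" "card S = max_winnable G s"
    by (rule max_winnable_attained)
  have "assignments G s \<subseteq> assignments G t"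
    using \<open>s \<le> t\<close> unfolding assignments_def by (intro PiE_mono) auto
  then have "winnable G t S" using S(1) by (auto simp: winnable_def)
  with S(2) show "max_winnable G s \<le> max_winnable G t"
    using card_le_max_winnable by metis
qed

text \<open>
  Over an alphabet of size \<open>s * t\<close> every value is a pair of digits, and the players play the two
  games for the high and the low digit independently.
\<close>

lemma max_winnable_supermultiplicative:
  "max_winnable G s * max_winnable G t \<le> max_winnable G (s * t)"
proof -
  obtain S where S: "winnable G s S" "card S = max_winnable G s"
    by (rule max_winnable_attained)
  obtain T where T: "winnable G t T" "card T = max_winnable G t"
    by (rule max_winnable_attained)
  define pair where "pair = (\<lambda>(a, b). \<lambda>v\<in>pverts G. a v * t + b v)"
  have digits: "a v < s" "b v < t" if "(a, b) \<in> S \<times> T" "v \<in> pverts G" for a b v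
    using winnable_less[OF S(1)] winnable_less[OF T(1)] that by auto
  have digits_eq: "a v = a' v \<and> b v = b' v"
    if "(a, b) \<in> S \<times> T" "(a', b') \<in> S \<times> T" "v \<in> pverts G" "pair (a, b) v = pair (a', b') v"
    for a b a' b' v
  proof -
    have e: "a v * t + b v = a' v * t + b' v" using that by (simp add: pair_def)
    have lt: "b v < t" "b' v < t" using digits that by auto
    have "(a v * t + b v) div t = a v" "(a' v * t + b' v) div t = a' v"
      "(a v * t + b v) mod t = b v" "(a' v * t + b' v) mod t = b' v"
      using lt by auto
    then show ?thesis using e by metis
  qed
  have "inj_on pair (S \<times> T)"
  proof (rule inj_onI, clarify)
    fix a b a' b'
    assume ab: "a \<in> S" "b \<in> T" "a' \<in> S" "b' \<in> T" and eq: "pair (a, b) = pair (a', b')"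
    then have "a v = a' v \<and> b v = b' v" if "v \<in> pverts G" for v
      using digits_eq[of a b a' b' v] that by simp
    moreover have "a \<in> extensional (pverts G)" "a' \<in> extensional (pverts G)"
      "b \<in> extensional (pverts G)" "b' \<in> extensional (pverts G)"
      using ab winnable_extensional[OF S(1)] winnable_extensional[OF T(1)] by auto
    ultimately show "a = a' \<and> b = b'" by (metis extensionalityI)
  qed
  moreover have "winnable G (s * t) (pair ` (S \<times> T))"
    unfolding winnable_def
  proof (intro conjI ballI impI)
    have "a v * t + b v < s * t" if "(a, b) \<in> S \<times> T" "v \<in> pverts G" for a b v
    proof -
      have "a v * t + b v < (a v + 1) * t" using digits[OF that] by simp
      also have "\<dots> \<le> s * t" using digits[OF that] by (intro mult_le_mono1) simp
      finally show ?thesis .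
    qed
    then show "pair ` (S \<times> T) \<subseteq> assignments G (s * t)"
      by (auto simp: pair_def assignments_def)
    fix c c' v
    assume "c \<in> pair ` (S \<times> T)" "c' \<in> pair ` (S \<times> T)" and v: "v \<in> pverts G"
      and agree: "\<forall>u\<in>neighbourhood G v. c u = c' u"
    then obtain a b a' b' where ab: "(a, b) \<in> S \<times> T" "(a', b') \<in> S \<times> T"
      and c: "c = pair (a, b)" "c' = pair (a', b')" by auto
    have "a u = a' u \<and> b u = b' u" if "u \<in> neighbourhood G v" for u
      using digits_eq[OF ab, of u] agree that neighbourhood_subset c by auto
    then have "a v = a' v" "b v = b' v"
      using winnable_eq[OF S(1), of a a' v] winnable_eq[OF T(1), of b b' v] ab v by auto
    then show "c v = c' v" using c v by (simp add: pair_def)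
  qed
  ultimately show ?thesis
    using card_le_max_winnable[of "s * t" "pair ` (S \<times> T)"] S(2) T(2)
    by (simp add: card_image card_cartesian_product)
qed

lemma assignment_pmf_eq:
  assumes "s \<ge> 1"
  shows "assignment_pmf G s = pmf_of_set (assignments G s)"
proof -
  have "PiE_dflt (pverts G) undefined (\<lambda>_. {..<s}) = assignments G s"
    by (auto simp: PiE_dflt_def assignments_def PiE_def extensional_def Pi_def)
  moreover have "0 \<in> {..<s}" using assms by simp
  ultimately show ?thesis
    unfolding assignment_pmf_def using pair_finite_verts
    by (subst Pi_pmf_of_set) auto
qed

lemma prob_Win:
  assumes "s \<ge> 1"
  shows "measure_pmf.prob (assignment_pmf G s) (Win G F) =
    real (card (Win G F \<inter> assignments G s)) / real s ^ card (pverts G)"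
proof -
  have "assignments G s \<noteq> {}"
    using assms card_assignments[of s] by auto
  then show ?thesis
    using assms
    by (simp add: assignment_pmf_eq measure_pmf_of_set card_assignments Int_commute)
qed

lemma Max_prob_Win:
  assumes s: "s \<ge> 1"
  shows "Max ((\<lambda>F. measure_pmf.prob (assignment_pmf G s) (Win G F)) ` strategies G s) =
    real (max_winnable G s) / real s ^ card (pverts G)"
proof (rule Max_eqI)
  show "finite ((\<lambda>F. measure_pmf.prob (assignment_pmf G s) (Win G F)) ` strategies G s)"
    using finite_strategies by simp
next
  fix p assume "p \<in> (\<lambda>F. measure_pmf.prob (assignment_pmf G s) (Win G F)) ` strategies G s"
  then show "p \<le> real (max_winnable G s) / real s ^ card (pverts G)"
    using card_le_max_winnable[OF winnable_Win] s
    by (auto simp: prob_Win intro!: divide_right_mono)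
next
  obtain S where S: "winnable G s S" "card S = max_winnable G s"
    by (rule max_winnable_attained)
  obtain F where F: "F \<in> strategies G s" "S \<subseteq> Win G F"
    using winnable_strategy[OF S(1) s] .
  have "max_winnable G s \<le> card (Win G F \<inter> assignments G s)"
    unfolding S(2)[symmetric] using S(1) F(2) by (intro card_mono) (auto simp: winnable_def)
  then have "card (Win G F \<inter> assignments G s) = max_winnable G s"
    using card_le_max_winnable[OF winnable_Win[of G s F]] by simp
  then show "real (max_winnable G s) / real s ^ card (pverts G) \<in>
    (\<lambda>F. measure_pmf.prob (assignment_pmf G s) (Win G F)) ` strategies G s"
    using F(1) s by (intro image_eqI[of _ _ F]) (simp_all add: prob_Win)
qed

lemma guessing_number_at_eq:
  assumes s: "s \<ge> 2"
  shows "guessing_number_at G s = log s (max_winnable G s)"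
proof -
  have "max_winnable G s \<ge> 1" using max_winnable_pos s by simp
  then show ?thesis
    unfolding guessing_number_at_def using s
    by (simp add: Max_prob_Win log_divide log_nat_power)
qed

lemma log_max_winnable_le:
  assumes "s \<ge> 2"
  shows "log s (max_winnable G s) \<le> card (pverts G)"
proof -
  have "real (max_winnable G s) \<le> real s ^ card (pverts G)"
    using max_winnable_le[of s] by (metis of_nat_le_iff of_nat_power)
  then have "log s (max_winnable G s) \<le> log s (real s ^ card (pverts G))"
    using assms max_winnable_pos[of s] by (subst log_le_cancel_iff) auto
  then show ?thesis using assms by (simp add: log_nat_power)
qed

text \<open>
  The limit exists and is the supremum of its terms. A lower bound for a single alphabet
  is therefore a lower bound for the asymptotic guessing number.
\<close>

theorem guessing_number_at_le_guessing_number: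
  assumes "s \<ge> 2"
  shows "guessing_number_at G s \<le> guessing_number G"
proof -
  let ?f = "\<lambda>s. log (real s) (real (max_winnable G s))"
  have bdd: "bdd_above (?f ` {2..})"
    using log_max_winnable_le by (intro bdd_aboveI2) simp
  have "?f \<longlonglongrightarrow> (SUP s\<in>{2..}. ?f s)"
    using mono_max_winnable max_winnable_pos max_winnable_supermultiplicative bdd
    by (rule supermultiplicative_log_tendsto_SUP)
  moreover have "\<forall>\<^sub>F s in sequentially. guessing_number_at G s = ?f s"
    using eventually_ge_at_top[of 2] by eventually_elim (rule guessing_number_at_eq)
  ultimately have "guessing_number_at G \<longlonglongrightarrow> (SUP s\<in>{2..}. ?f s)"
    by (simp cong: tendsto_cong)
  then have "guessing_number G = (SUP s\<in>{2..}. ?f s)"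
    unfolding guessing_number_def by (rule limI)
  then show ?thesis
    using assms bdd by (auto simp: guessing_number_at_eq intro: cSUP_upper)
qed

text \<open>
  \<open>g\<close> is a public syndrome that, together with what a player sees, determines that player's value.
  Then every fibre of \<open>g\<close> is winnable, and a largest fibre contains at least the fraction
  $s^{-r}$ of all assignments. A linear \<open>g\<close> of rank \<open>r\<close> over a field with \<open>s\<close> elements is the typical instance.
\<close>

lemma guessing_number_at_ge_of_checks:
  assumes s: "s \<ge> 2"
    and g: "g \<in> assignments G s \<rightarrow> T" and T: "finite T" "card T \<le> s ^ r"
    and checks: "\<And>a b v. \<lbrakk>a \<in> assignments G s; b \<in> assignments G s; g a = g b;
      v \<in> pverts G; \<forall>u\<in>neighbourhood G v. a u = b u\<rbrakk> \<Longrightarrow> a v = b v"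
  shows "guessing_number_at G s \<ge> real (card (pverts G)) - real r"
proof -
  have "assignments G s \<noteq> {}"
    using s card_assignments[of s] by auto
  then have "T \<noteq> {}" using g by auto
  then obtain y where y: "card (g -` {y} \<inter> assignments G s) * card T \<ge> card (assignments G s)"
    using pigeonhole_card[OF g _ T(1)] by auto
  have "winnable G s (g -` {y} \<inter> assignments G s)"
    unfolding winnable_def using checks by auto
  then have "card (g -` {y} \<inter> assignments G s) \<le> max_winnable G s"
    by (rule card_le_max_winnable)
  then have "card (g -` {y} \<inter> assignments G s) * card T \<le> max_winnable G s * s ^ r"
    using T(2) by (rule mult_le_mono)
  with y have "s ^ card (pverts G) \<le> max_winnable G s * s ^ r"
    by (simp add: card_assignments)
  then have "real s ^ card (pverts G) \<le> real (max_winnable G s) * real s ^ r"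
    by (metis of_nat_le_iff of_nat_power of_nat_mult)
  then have "log s (real s ^ card (pverts G)) \<le> log s (real (max_winnable G s) * real s ^ r)"
    using s max_winnable_pos[of s] by (subst log_le_cancel_iff) auto
  then show ?thesis
    using s max_winnable_pos[of s] by (simp add: guessing_number_at_eq log_mult log_nat_power)
qed

end


section \<open>A Steiner system with 77 hexads on 22 points\<close>

text \<open>
  The points are two copies of \<open>\<int>/11\<close>: \<open>p < 11\<close> stands for the residue \<open>p\<close> in the first copy and
  \<open>11 + p\<close> for the same residue in the second one. Writing hexads as \<open>X | Y\<close> with one part in each copy,
  the base hexads are \<open>N | 0\<close> and \<open>0 | Q\<close>, where \<open>Q = {1, 3, 4, 5, 9}\<close> and \<open>N\<close> are the nonzero squares
  and the non-squares modulo 11, and the five multiples of \<open>0, 1, 8 | 0, 3, 10\<close> by the elements of \<open>Q\<close>.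
  Their translates by \<open>\<int>/11\<close> are the 77 blocks of the Steiner system \<open>S(3, 6, 22)\<close>.
\<close>

definition base_hexads :: "nat list list" where
  "base_hexads =
    [[2, 6, 7, 8, 10, 11], [0, 12, 14, 15, 16, 20],
     [0, 1, 8, 11, 14, 21], [0, 3, 2, 11, 20, 19], [0, 9, 6, 11, 16, 13],
     [0, 5, 7, 11, 15, 17], [0, 4, 10, 11, 12, 18]]"

definition rotate_point :: "nat \<Rightarrow> nat \<Rightarrow> nat" where
  "rotate_point t p = (if p < 11 then (p + t) mod 11 else 11 + (p + t) mod 11)"

definition hexad_list :: "nat \<Rightarrow> nat list" where
  "hexad_list k = map (rotate_point (k mod 11)) (base_hexads ! (k div 11))"

definition hexad :: "nat \<Rightarrow> nat set" where
  "hexad k = set (hexad_list k)"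

text \<open>
  The design properties that the proof relies on are finite checks. They are phrased with lists and
  lengths, and tabulate the hexads once, to be fast for the simplifier.
\<close>

lemma hexad_lists_valid:
  "list_all (\<lambda>xs. distinct xs \<and> length xs = 6 \<and> list_all (\<lambda>p. p < 22) xs) (map hexad_list [0..<77])"
  by code_simp

lemma hexad_lists_intersections:
  "sorted_wrt (\<lambda>xs ys. length (filter (List.member ys) xs) \<in> {0, 2}) (map hexad_list [0..<77])"
  by code_simp

lemma hexad_lists_point_degree:
  "(let Hs = map hexad_list [0..<77] in
    list_all (\<lambda>p. length (filter (\<lambda>xs. List.member xs p) Hs) = 21) [0..<22])"
  by code_simp

lemma hexad_lists_pair_degree:
  "(let Hs = map hexad_list [0..<77] in
    list_all (\<lambda>p. let Ps = filter (\<lambda>xs. List.member xs p) Hs in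
      list_all (\<lambda>q. length (filter (\<lambda>xs. List.member xs q) Ps) = 5) [0..<p]) [0..<22])"
  by code_simp

lemma finite_hexad [simp]: "finite (hexad k)"
  by (simp add: hexad_def)

lemma hexad_list_props:
  assumes "k < 77"
  shows "distinct (hexad_list k)" "length (hexad_list k) = 6" "\<forall>p\<in>set (hexad_list k). p < 22"
  using hexad_lists_valid assms by (auto simp: list_all_iff)

lemma hexad_subset: "k < 77 \<Longrightarrow> hexad k \<subseteq> {..<22}"
  using hexad_list_props(3) by (auto simp: hexad_def)

lemma card_hexad: "k < 77 \<Longrightarrow> card (hexad k) = 6"
  using hexad_list_props(1,2) by (simp add: hexad_def distinct_card)

lemma card_hexad_Int:
  assumes "j < 77" "k < 77" "j \<noteq> k"
  shows "card (hexad j \<inter> hexad k) \<in> {0, 2}"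
proof -
  have *: "card (hexad j \<inter> hexad k) \<in> {0, 2}" if "j < k" "k < 77" for j k
  proof -
    have "sorted_wrt (\<lambda>j k. length (filter (List.member (hexad_list k)) (hexad_list j)) \<in> {0, 2}) [0..<77]"
      using hexad_lists_intersections unfolding sorted_wrt_map .
    then have "length (filter (List.member (hexad_list k)) (hexad_list j)) \<in> {0, 2}"
      using sorted_wrt_nth_less[of _ "[0..<77]" j k] that by auto
    moreover have "hexad j \<inter> hexad k = set (filter (List.member (hexad_list k)) (hexad_list j))"
      by (auto simp: hexad_def)
    moreover have "distinct (filter (List.member (hexad_list k)) (hexad_list j))"
      using that hexad_list_props(1)[of j] by simp
    ultimately show ?thesis by (metis distinct_card)
  qed
  show ?thesis
    using *[of j k] *[of k j] assms by (cases j k rule: linorder_cases) (auto simp: Int_commute)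
qed

lemma card_hexads_through_point:
  assumes "p < 22"
  shows "card {k. k < 77 \<and> p \<in> hexad k} = 21"
proof -
  have "length (filter (\<lambda>k. p \<in> hexad k) [0..<77]) = 21"
    using hexad_lists_point_degree assms
    by (auto simp: list_all_iff filter_map comp_def hexad_def Let_def)
  moreover have "card (set (filter (\<lambda>k. p \<in> hexad k) [0..<77])) =
      length (filter (\<lambda>k. p \<in> hexad k) [0..<77])"
    by (intro distinct_card) simp
  moreover have "set (filter (\<lambda>k. p \<in> hexad k) [0..<77]) = {k. k < 77 \<and> p \<in> hexad k}"
    by auto
  ultimately show ?thesis by simp
qed

lemma card_hexads_through_pair:
  assumes "p < 22" "q < 22" "p \<noteq> q"
  shows "card {k. k < 77 \<and> p \<in> hexad k \<and> q \<in> hexad k} = 5"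
proof -
  have *: "card {k. k < 77 \<and> p \<in> hexad k \<and> q \<in> hexad k} = 5" if "q < p" "p < 22" for p q
  proof -
    let ?ks = "filter (\<lambda>k. p \<in> hexad k \<and> q \<in> hexad k) [0..<77]"
    have "length ?ks = 5"
      using hexad_lists_pair_degree that
      by (auto simp: list_all_iff filter_map comp_def hexad_def Let_def conj_commute)
    moreover have "card (set ?ks) = length ?ks" by (intro distinct_card) simp
    moreover have "set ?ks = {k. k < 77 \<and> p \<in> hexad k \<and> q \<in> hexad k}"
      by auto
    ultimately show ?thesis by simp
  qed
  show ?thesis
    using *[of p q] *[of q p] assms by (cases p q rule: linorder_cases) (auto simp: conj_commute)
qed

lemma card_Int_eq_sum:
  "finite A \<Longrightarrow> int (card (B \<inter> A)) = (\<Sum>p\<in>A. of_bool (p \<in> B))"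
  by (simp add: of_bool_def sum.If_cases Int_commute)

text \<open>
  Let \<open>A\<close> and \<open>B\<close> be disjoint hexads. As every point lies in 21 hexads and any two points in 5,
  counting incidences gives
  \<open>\<Sum>\<^sub>D (2 - |D \<inter> A|) (2 - |D \<inter> B|) = 4 * 77 - 2 * 126 - 2 * 126 + 180 = -16\<close>.
  The terms for \<open>D = A\<close> and \<open>D = B\<close> contribute \<open>-8\<close> each, and all other terms are nonnegative
  because hexads meet in at most two points. So all other terms vanish, whereas a hexad disjoint
  from both \<open>A\<close> and \<open>B\<close> would contribute \<open>4\<close>.
\<close>

lemma no_three_disjoint_hexads:
  assumes ijk: "i < 77" "j < 77" "k < 77"
    and ij: "hexad i \<inter> hexad j = {}" and ki: "hexad k \<inter> hexad i = {}"
    and kj: "hexad k \<inter> hexad j = {}"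
  shows False
proof -
  define a where "a l = int (card (hexad l \<inter> hexad i))" for l
  define b where "b l = int (card (hexad l \<inter> hexad j))" for l
  have sum_point: "(\<Sum>l<77. int (card (hexad l \<inter> hexad m))) = 126" if m: "m < 77" for m
  proof -
    have "(\<Sum>l<77. int (card (hexad l \<inter> hexad m))) =
        (\<Sum>p\<in>hexad m. \<Sum>l<77. of_bool (p \<in> hexad l))"
      by (simp add: card_Int_eq_sum sum.swap[of _ "{..<77}"] del: of_bool_eq_iff sum_of_bool_eq)
    also have "\<dots> = (\<Sum>p\<in>hexad m. 21)"
    proof (rule sum.cong)
      fix p assume "p \<in> hexad m"
      then have "p < 22" using hexad_subset[OF m] by auto
      moreover have "{..<77} \<inter> {l. p \<in> hexad l} = {k. k < 77 \<and> p \<in> hexad k}" by auto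
      ultimately show "(\<Sum>l<77. of_bool (p \<in> hexad l)) = (21::int)"
        by (simp add: of_bool_def sum.If_cases card_hexads_through_point)
    qed simp
    finally show ?thesis using card_hexad[OF m] by simp
  qed
  have sum_ab: "(\<Sum>l<77. a l * b l) = 180"
  proof -
    have "(\<Sum>l<77. a l * b l) =
        (\<Sum>l<77. \<Sum>p\<in>hexad i. \<Sum>q\<in>hexad j. of_bool (p \<in> hexad l \<and> q \<in> hexad l))"
      unfolding a_def b_def
      by (simp add: card_Int_eq_sum sum_product of_bool_conj del: sum_of_bool_eq)
    also have "\<dots> = (\<Sum>p\<in>hexad i. \<Sum>l<77. \<Sum>q\<in>hexad j. of_bool (p \<in> hexad l \<and> q \<in> hexad l))"
      by (rule sum.swap)
    also have "\<dots> = (\<Sum>p\<in>hexad i. \<Sum>q\<in>hexad j. \<Sum>l<77. of_bool (p \<in> hexad l \<and> q \<in> hexad l))"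
      by (intro sum.cong refl sum.swap)
    also have "\<dots> = (\<Sum>p\<in>hexad i. \<Sum>q\<in>hexad j. 5)"
    proof (intro sum.cong refl)
      fix p q assume "p \<in> hexad i" "q \<in> hexad j"
      then have "p < 22" "q < 22" "p \<noteq> q"
        using hexad_subset ijk ij by auto
      moreover have "{..<77} \<inter> {l. p \<in> hexad l \<and> q \<in> hexad l} =
          {k. k < 77 \<and> p \<in> hexad k \<and> q \<in> hexad k}" by auto
      ultimately show "(\<Sum>l<77. of_bool (p \<in> hexad l \<and> q \<in> hexad l)) = (5::int)"
        by (simp add: of_bool_def sum.If_cases card_hexads_through_pair)
    qed
    finally show ?thesis using card_hexad ijk by simp
  qed
  have "(\<Sum>l<77. (2 - a l) * (2 - b l)) =
      (\<Sum>l<77. 4 - 2 * a l - 2 * b l + a l * b l)"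
    by (intro sum.cong) (auto simp: algebra_simps)
  also have "\<dots> = 4 * 77 - 2 * (\<Sum>l<77. a l) - 2 * (\<Sum>l<77. b l) + (\<Sum>l<77. a l * b l)"
    by (simp add: sum.distrib sum_subtractf sum_distrib_left)
  also have "\<dots> = -16"
    using sum_point[OF ijk(1)] sum_point[OF ijk(2)] sum_ab unfolding a_def b_def by simp
  finally have total: "(\<Sum>l<77. (2 - a l) * (2 - b l)) = -16" .
  have ne: "hexad i \<noteq> {}" "hexad j \<noteq> {}" "hexad k \<noteq> {}"
    using card_hexad ijk by fastforce+
  then have distinct: "i \<noteq> j" "k \<noteq> i" "k \<noteq> j" using ij ki kj by auto
  have vals: "a i = 6" "b i = 0" "a j = 0" "b j = 6" "a k = 0" "b k = 0"
    using ij ki kj card_hexad ijk by (auto simp: a_def b_def Int_commute)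
  have "0 \<le> (\<Sum>l\<in>{..<77} - {i, j, k}. (2 - a l) * (2 - b l))"
  proof (intro sum_nonneg mult_nonneg_nonneg)
    fix l assume "l \<in> {..<77} - {i, j, k}"
    then show "0 \<le> 2 - a l" "0 \<le> 2 - b l"
      using card_hexad_Int[of l i] card_hexad_Int[of l j] ijk by (auto simp: a_def b_def)
  qed
  moreover have "(\<Sum>l<77. (2 - a l) * (2 - b l)) =
      (\<Sum>l\<in>{i, j, k}. (2 - a l) * (2 - b l)) + (\<Sum>l\<in>{..<77} - {i, j, k}. (2 - a l) * (2 - b l))"
    using ijk by (subst add.commute, intro sum.subset_diff) auto
  ultimately show False using total distinct vals by simp
qed


section \<open>The Higman-Sims graph\<close>

text \<open>
  The vertices are the 22 points, one further vertex \<open>22\<close> adjacent to all points, and the hexads,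
  where \<open>hexad k\<close> is the vertex \<open>23 + k\<close>. A hexad is adjacent to its points and to the hexads
  disjoint from it. Each kind of edge is listed in one direction and symmetrised afterwards.
\<close>

definition higman_sims_adj :: "nat \<Rightarrow> nat \<Rightarrow> bool" where
  "higman_sims_adj u v \<longleftrightarrow>
     u < 22 \<and> v = 22 \<or>
     u < 22 \<and> v \<in> {23..<100} \<and> u \<in> hexad (v - 23) \<or>
     u \<in> {23..<100} \<and> v \<in> {23..<100} \<and> hexad (u - 23) \<inter> hexad (v - 23) = {}"

definition higman_sims :: "nat pair_pre_digraph" where
  "higman_sims =
     \<lparr>pverts = {..<100}, parcs = {(u, v). higman_sims_adj u v \<or> higman_sims_adj v u}\<rparr>"

lemma pverts_higman_sims [simp]: "pverts higman_sims = {..<100}"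
  by (simp add: higman_sims_def)

lemma higman_sims_vertex_cases:
  assumes "v < (100::nat)"
  obtains (point) "v < 22" | (infinity) "v = 22" | (hexad) k where "k < 77" "v = 23 + k"
proof -
  consider "v < 22" | "v = 22" | "v \<ge> 23" by linarith
  then show ?thesis
  proof cases
    case 3
    then show ?thesis using assms hexad[of "v - 23"] by simp
  qed (use point infinity in auto)
qed

lemma parcs_higman_sims_lt:
  "(u, v) \<in> parcs higman_sims \<Longrightarrow> u < 100 \<and> v < 100"
  by (auto simp: higman_sims_def higman_sims_adj_def)

lemma hexad_nonempty: "k < 77 \<Longrightarrow> hexad k \<noteq> {}"
  using card_hexad[of k] by auto

lemma parcs_higman_sims:
  "\<lbrakk>p < 22; q < 22\<rbrakk> \<Longrightarrow> (p, q) \<notin> parcs higman_sims"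
  "(22, 22) \<notin> parcs higman_sims"
  "p < 22 \<Longrightarrow> (p, 22) \<in> parcs higman_sims"
  "p < 22 \<Longrightarrow> (22, p) \<in> parcs higman_sims"
  "(22, 23 + k) \<notin> parcs higman_sims"
  "(23 + k, 22) \<notin> parcs higman_sims"
  "\<lbrakk>p < 22; k < 77\<rbrakk> \<Longrightarrow> (p, 23 + k) \<in> parcs higman_sims \<longleftrightarrow> p \<in> hexad k"
  "\<lbrakk>p < 22; k < 77\<rbrakk> \<Longrightarrow> (23 + k, p) \<in> parcs higman_sims \<longleftrightarrow> p \<in> hexad k"
  "\<lbrakk>j < 77; k < 77\<rbrakk> \<Longrightarrow> (23 + j, 23 + k) \<in> parcs higman_sims \<longleftrightarrow> hexad j \<inter> hexad k = {}"
  by (auto simp: higman_sims_def higman_sims_adj_def)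

lemma sym_parcs_higman_sims: "(u, v) \<in> parcs higman_sims \<Longrightarrow> (v, u) \<in> parcs higman_sims"
  by (auto simp: higman_sims_def)

lemma higman_sims_irreflexive: "(v, v) \<notin> parcs higman_sims"
proof
  assume v: "(v, v) \<in> parcs higman_sims"
  then have "v < 100" using parcs_higman_sims_lt by blast
  then show False
    by (cases rule: higman_sims_vertex_cases)
      (use v hexad_nonempty in \<open>auto simp: parcs_higman_sims\<close>)
qed

lemma pair_graph_higman_sims: "pair_graph higman_sims"
proof
  show "finite (parcs higman_sims)"
    by (rule finite_subset[of _ "{..<100} \<times> {..<100}"]) (auto dest: parcs_higman_sims_lt)
  have "sym (parcs higman_sims)"
    using sym_parcs_higman_sims by (rule symI)
  then show "symmetric (with_proj higman_sims)"
    unfolding symmetric_def by (simp add: with_proj_def arcs_ends_def arc_to_ends_def)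
qed (use parcs_higman_sims_lt higman_sims_irreflexive in force)+

lemma triangle_free_higman_sims: "triangle_free higman_sims"
  unfolding triangle_free_def
proof (intro notI, elim exE conjE)
  fix x y z
  assume arcs: "(x, y) \<in> parcs higman_sims" "(y, z) \<in> parcs higman_sims" "(x, z) \<in> parcs higman_sims"
  have "x < 100" "y < 100" "z < 100" using arcs parcs_higman_sims_lt by blast+
  show False
    by (rule higman_sims_vertex_cases[OF \<open>x < 100\<close>]; rule higman_sims_vertex_cases[OF \<open>y < 100\<close>];
        rule higman_sims_vertex_cases[OF \<open>z < 100\<close>])
      (use arcs no_three_disjoint_hexads in \<open>auto simp: parcs_higman_sims Int_commute\<close>)
qed

section \<open>Twenty-three checks modulo 3\<close>

text \<open>
  The checks are one functional \<open>T\<^sub>p\<close> for each point \<open>p\<close>, namely the row of \<open>p\<close> in \<open>A + I\<close>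
  for the adjacency matrix \<open>A\<close>, and the sum \<open>U\<close> over all hexads. Modulo 3 they span every
  row of \<open>A + I\<close>:

  \<^item> The sum of all \<open>T\<^sub>p\<close> is the row of vertex \<open>22\<close>, because
  \<open>22 \<equiv> 1\<close> and every hexad is counted \<open>6 \<equiv> 0\<close> times.

  \<^item> For a hexad \<open>B\<close>, the sum of \<open>T\<^sub>p\<close> over \<open>p \<in> B\<close> counts vertex \<open>22\<close> and \<open>B\<close> itself
  \<open>6 \<equiv> 0\<close> times and every other hexad that meets \<open>B\<close> twice. Adding \<open>U\<close> turns these coefficients into
  1 for \<open>B\<close>, 0 for the other hexads meeting \<open>B\<close>, and 1 for the hexads disjoint from \<open>B\<close>: the row of \<open>B\<close>.

  In the statement \<open>d\<close> is the difference of two assignments with equal checks; a row of \<open>A + I\<close>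
  together with vanishing of \<open>d\<close> on the neighbourhood determines \<open>d\<close> at the vertex modulo 3.
\<close>

lemma higman_sims_checks_determine_vertex:
  fixes d :: "nat \<Rightarrow> int"
  assumes point_check: "\<And>p. p < 22 \<Longrightarrow>
      3 dvd d p + d 22 + (\<Sum>k<77. of_bool (p \<in> hexad k) * d (23 + k))"
    and hexad_check: "3 dvd (\<Sum>k<77. d (23 + k))"
    and v: "v < 100" and nbhd: "\<And>u. u \<in> neighbourhood higman_sims v \<Longrightarrow> d u = 0"
  shows "3 dvd d v"
proof -
  have nbhd: "d u = 0" if "(v, u) \<in> parcs higman_sims" for u
    using nbhd that by (simp add: neighbourhood_def)
  have sum_checks: "3 dvd (\<Sum>p\<in>A. d p) + int (card A) * d 22
      + (\<Sum>k<77. int (card (hexad k \<inter> A)) * d (23 + k))" if A: "A \<subseteq> {..<22}" for A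
  proof -
    have "finite A" using A finite_subset by blast
    have "3 dvd (\<Sum>p\<in>A. d p + d 22 + (\<Sum>k<77. of_bool (p \<in> hexad k) * d (23 + k)))"
      using A by (intro dvd_sum point_check) auto
    also have "(\<Sum>p\<in>A. d p + d 22 + (\<Sum>k<77. of_bool (p \<in> hexad k) * d (23 + k))) =
        (\<Sum>p\<in>A. d p) + int (card A) * d 22
          + (\<Sum>p\<in>A. \<Sum>k<77. of_bool (p \<in> hexad k) * d (23 + k))"
      by (simp only: sum.distrib sum_constant)
    also have "(\<Sum>p\<in>A. \<Sum>k<77. of_bool (p \<in> hexad k) * d (23 + k)) =
        (\<Sum>k<77. \<Sum>p\<in>A. of_bool (p \<in> hexad k) * d (23 + k))"
      by (rule sum.swap)
    also have "\<dots> = (\<Sum>k<77. int (card (hexad k \<inter> A)) * d (23 + k))"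
      by (simp only: card_Int_eq_sum[OF \<open>finite A\<close>] sum_distrib_right)
    finally show ?thesis .
  qed
  from v show ?thesis
  proof (cases rule: higman_sims_vertex_cases)
    case point
    have "d 22 = 0" using nbhd point parcs_higman_sims by blast
    moreover have "(\<Sum>k<77. of_bool (v \<in> hexad k) * d (23 + k)) = 0"
      using nbhd point by (intro sum.neutral) (simp add: parcs_higman_sims)
    ultimately show ?thesis using point_check[OF point] by simp
  next
    case infinity
    have "(\<Sum>p<22. d p) = 0"
      using nbhd infinity by (intro sum.neutral) (simp add: parcs_higman_sims)
    moreover have "(\<Sum>k<77. int (card (hexad k \<inter> {..<22})) * d (23 + k)) =
        6 * (\<Sum>k<77. d (23 + k))"
    proof -
      have "hexad k \<inter> {..<22} = hexad k" if "k < 77" for k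
        using hexad_subset that by blast
      then show ?thesis unfolding sum_distrib_left
        by (intro sum.cong refl) (simp add: card_hexad)
    qed
    ultimately have "3 dvd 22 * d 22 + 6 * (\<Sum>k<77. d (23 + k))"
      using sum_checks[of "{..<22}"] by simp
    then have "3 dvd 22 * d 22" using hexad_check by presburger
    then show ?thesis using infinity by presburger
  next
    case (hexad j)
    have "(\<Sum>p\<in>hexad j. d p) = 0"
      using nbhd hexad hexad_subset[of j] by (intro sum.neutral) (auto simp: parcs_higman_sims)
    \<comment> \<open>The intersection has size \<open>6 = 2 + 4\<close> for \<open>k = j\<close> and size 2 or 0 otherwise; where it is 0,
      the hexads are adjacent, so \<open>d\<close> vanishes there and the coefficient may be taken to be 2 as well.\<close>
    moreover have "(\<Sum>k<77. int (card (hexad k \<inter> hexad j)) * d (23 + k)) =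
        (\<Sum>k<77. 2 * d (23 + k) + (if k = j then 4 * d (23 + j) else 0))"
    proof (intro sum.cong refl)
      fix k assume "k \<in> {..<77::nat}"
      then have k: "k < 77" by simp
      consider "k = j" | "k \<noteq> j" "hexad j \<inter> hexad k = {}" | "k \<noteq> j" "card (hexad k \<inter> hexad j) = 2"
        using card_hexad_Int[OF k hexad(1)] by (auto simp: Int_commute)
      then show "int (card (hexad k \<inter> hexad j)) * d (23 + k) =
          2 * d (23 + k) + (if k = j then 4 * d (23 + j) else 0)"
      proof cases
        case 1
        then show ?thesis using card_hexad[OF hexad(1)] by simp
      next
        case 2
        then have "d (23 + k) = 0"
          using nbhd[of "23 + k"] hexad k by (simp add: parcs_higman_sims)
        with 2 show ?thesis by simp
      qed simp
    qed
    moreover have "\<dots> = 2 * (\<Sum>k<77. d (23 + k)) + 4 * d (23 + j)"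
      using hexad(1) by (simp add: sum.distrib sum_distrib_left)
    ultimately have "3 dvd 6 * d 22 + (2 * (\<Sum>k<77. d (23 + k)) + 4 * d (23 + j))"
      using sum_checks[OF hexad_subset[OF hexad(1)]] card_hexad[OF hexad(1)] by simp
    then have "3 dvd d (23 + j)" using hexad_check by presburger
    then show ?thesis using hexad(2) by simp
  qed
qed

text \<open>
  The coordinates \<open>i < 22\<close> are the point checks, and coordinate \<open>22\<close> is the sum over the hexads.
\<close>

definition higman_sims_check :: "(nat \<Rightarrow> nat) \<Rightarrow> nat \<Rightarrow> nat" where
  "higman_sims_check a = (\<lambda>i\<in>{..<23}.
     (if i < 22 then a i + a 22 + (\<Sum>k<77. of_bool (i \<in> hexad k) * a (23 + k))
      else \<Sum>k<77. a (23 + k)) mod 3)"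

lemma int_diff_dvd_iff_mod_eq: "int m dvd int x - int y \<longleftrightarrow> x mod m = y mod m"
  by (metis mod_eq_dvd_iff of_nat_eq_iff of_nat_mod)

lemma higman_sims_check_injective:
  assumes less: "a v < 3" "b v < 3" and eq: "higman_sims_check a = higman_sims_check b"
    and v: "v < 100" and agree: "\<forall>u\<in>neighbourhood higman_sims v. a u = b u"
  shows "a v = b v"
proof -
  define d where "d u = int (a u) - int (b u)" for u
  have "3 dvd d v"
  proof (rule higman_sims_checks_determine_vertex[OF _ _ v])
    fix p :: nat assume "p < 22"
    then have "(a p + a 22 + (\<Sum>k<77. of_bool (p \<in> hexad k) * a (23 + k))) mod 3 =
        (b p + b 22 + (\<Sum>k<77. of_bool (p \<in> hexad k) * b (23 + k))) mod 3"
      using fun_cong[OF eq, of p] by (simp add: higman_sims_check_def)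
    from this[folded int_diff_dvd_iff_mod_eq]
    show "3 dvd d p + d 22 + (\<Sum>k<77. of_bool (p \<in> hexad k) * d (23 + k))"
      by (simp add: d_def right_diff_distrib sum_subtractf algebra_simps)
  next
    have "(\<Sum>k<77. a (23 + k)) mod 3 = (\<Sum>k<77. b (23 + k)) mod 3"
      using fun_cong[OF eq, of 22] by (simp add: higman_sims_check_def)
    from this[folded int_diff_dvd_iff_mod_eq]
    show "3 dvd (\<Sum>k<77. d (23 + k))"
      by (simp add: d_def sum_subtractf)
  qed (use agree in \<open>simp add: d_def\<close>)
  then have "a v mod 3 = b v mod 3"
    using int_diff_dvd_iff_mod_eq[of 3] by (simp add: d_def)
  with less show ?thesis by simp
qed


section \<open>A triangle-free graph with guessing number at least 77\<close>

theorem theorem5p7: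
  shows "\<exists>G :: nat pair_pre_digraph.
           pair_graph G \<and> card (pverts G) = 100 \<and> triangle_free G \<and> guessing_number G \<ge> 77"
proof (intro exI conjI)
  interpret pair_graph higman_sims by (rule pair_graph_higman_sims)
  show "pair_graph higman_sims" by (rule pair_graph_higman_sims)
  show "card (pverts higman_sims) = 100" by simp
  show "triangle_free higman_sims" by (rule triangle_free_higman_sims)
  have "real (card (pverts higman_sims)) - real 23 \<le> guessing_number_at higman_sims 3"
  proof (rule guessing_number_at_ge_of_checks)
    show "higman_sims_check \<in> assignments higman_sims 3 \<rightarrow> ({..<23} \<rightarrow>\<^sub>E {..<3})"
      by (auto simp: higman_sims_check_def)
    show "card ({..<23::nat} \<rightarrow>\<^sub>E {..<3::nat}) \<le> 3 ^ 23"
      by (simp add: card_funcsetE)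
  next
    fix a b v
    assume "a \<in> assignments higman_sims 3" "b \<in> assignments higman_sims 3"
      "higman_sims_check a = higman_sims_check b" "v \<in> pverts higman_sims"
      "\<forall>u\<in>neighbourhood higman_sims v. a u = b u"
    then show "a v = b v"
      by (intro higman_sims_check_injective) (auto simp: assignments_def)
  qed (auto intro: finite_PiE)
  also have "\<dots> \<le> guessing_number higman_sims"
    by (rule guessing_number_at_le_guessing_number) simp
  finally show "guessing_number higman_sims \<ge> 77" by simp
qed

end
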